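(* Let $K$ be a field of characteristic different from two, $A=K[x_1,x_2,x_3]/(x_1^2+x_2^2+x_3^2-1)$, and $\Omega=\Omega_{A/K}$ the module of Kähler differentials. Let $\nabla:\operatorname{Der}_K(A)\to\operatorname{End}_K(\Omega)$ be the connection \[\nabla(\delta)(\omega)=\sum_{i=1}^3\delta(\xi_i(\omega))\,\overline{dx_i},\] where $\xi_1,\xi_2,\xi_3:\Omega\to A$ are the $A$-linear maps determined by $\xi_i(\overline{dx_j})=\delta_{ij}-x_ix_j$ (with $\delta_{ij}$ the Kronecker delta). Then: 1. $\nabla$ is non-flat, i.e. $R_\nabla\neq0$; 2. $\operatorname{tr}(R_\nabla)=0$; 3. $c_1(\Omega)=0$ in $\mathrm{H}^2(\operatorname{Der}_K(A),A)$.
   Context: $\Omega=A\{dx_1,dx_2,dx_3\}/(x_1dx_1+x_2dx_2+x_3dx_3)$, a locally free $A$-module of rank two; $\overline{dx_i}$ is the class of $dx_i$. The families $\overline{dx_i}$, $\xi_i$ form a projective basis of $\Omega$, i.e. $\sum_i\xi_i(\omega)\overline{dx_i}=\omega$ for all $\omega\in\Omega$; they come from the section $s(\overline{dx_i})=u_i-x_i(x_1u_1+x_2u_2+x_3u_3)$ of the surjection $A\{u_1,u_2,u_3\}\to\Omega$, $u_i\mapsto\overline{dx_i}$. The curvature is $R_\nabla(\delta\wedge\eta)=[\nabla(\delta),\nabla(\eta)]-\nabla([\delta,\eta])\in\operatorname{End}_A(\Omega)$, and $\operatorname{tr}(R_\nabla)$ is the map $\delta\wedge\eta\mapsto\operatorname{tr}(R_\nabla(\delta\wedge\eta))\in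 A$, with $\operatorname{tr}$ the trace of an endomorphism of the finitely generated projective $A$-module $\Omega$ (so $\operatorname{tr}(R)=\sum_i\xi_i(R(\overline{dx_i}))$). $\mathrm{H}^\bullet(\operatorname{Der}_K(A),A)$ is Lie–Rinehart cohomology: the cohomology of the complex $\operatorname{Hom}_A(\wedge_A^\bullet\operatorname{Der}_K(A),A)$ with the Chevalley–Eilenberg differential, where $\operatorname{Der}_K(A)$ acts on $A$ by derivations. The first Chern class $c_1(\Omega)\in\mathrm{H}^2(\operatorname{Der}_K(A),A)$ is the class of the 2-cocycle $\operatorname{tr}(R_\nabla)$. *)

theory Defs
  imports Complex_Main "HOL-Library.Poly_Mapping" "HOL-Library.Numeral_Type" "HOL-Algebra.Coset"
begin

section \<open>The coordinate ring of the sphere\<close>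

text \<open>Polynomials in \<open>x\<^sub>1, x\<^sub>2, x\<^sub>3\<close> are finitely supported functions on the exponents
  \<open>3 \<Rightarrow>\<^sub>0 nat\<close>. The index type \<open>3\<close> has exactly the elements \<open>1, 2, 3\<close> (with \<open>3 = 0\<close>).\<close>

type_synonym 'k poly3 = "(3 \<Rightarrow>\<^sub>0 nat) \<Rightarrow>\<^sub>0 'k"

definition pconst :: "'k::field \<Rightarrow> 'k poly3" where
  "pconst c = Poly_Mapping.single 0 c"

definition pvar :: "3 \<Rightarrow> 'k::field poly3" where
  "pvar i = Poly_Mapping.single (Poly_Mapping.single i 1) 1"

definition sphere_poly :: "'k::field poly3" where
  "sphere_poly = pvar 1 ^ 2 + pvar 2 ^ 2 + pvar 3 ^ 2 - 1"

definition sphere_eq :: "'k::field poly3 \<Rightarrow> 'k poly3 \<Rightarrow> bool" where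
  "sphere_eq p q \<longleftrightarrow> sphere_poly dvd (p - q)"

lemma equivp_sphere_eq: "equivp (sphere_eq :: 'k::field poly3 \<Rightarrow> _)"
proof (rule equivpI)
  show "reflp (sphere_eq :: 'k poly3 \<Rightarrow> _)" by (simp add: reflp_def sphere_eq_def)
  show "symp (sphere_eq :: 'k poly3 \<Rightarrow> _)"
    unfolding symp_def sphere_eq_def by (metis dvd_minus_iff minus_diff_eq)
  show "transp (sphere_eq :: 'k poly3 \<Rightarrow> _)"
  proof (rule transpI)
    fix p q r :: "'k poly3"
    assume "sphere_eq p q" "sphere_eq q r"
    hence "sphere_poly dvd (p - q) + (q - r)" unfolding sphere_eq_def by (rule dvd_add)
    thus "sphere_eq p r" by (simp add: sphere_eq_def)
  qed
qed

text \<open>Evaluation of polynomials at a point; it shows that the quotient ring is not zero.\<close>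

definition mono_eval :: "(3 \<Rightarrow> 'k::field) \<Rightarrow> (3 \<Rightarrow>\<^sub>0 nat) \<Rightarrow> 'k" where
  "mono_eval a m = (\<Prod>i\<in>UNIV. a i ^ Poly_Mapping.lookup m i)"

definition peval :: "(3 \<Rightarrow> 'k::field) \<Rightarrow> 'k poly3 \<Rightarrow> 'k" where
  "peval a p = (\<Sum>m\<in>Poly_Mapping.keys p. Poly_Mapping.lookup p m * mono_eval a m)"

lemma mono_eval_0 [simp]: "mono_eval a 0 = 1"
  by (simp add: mono_eval_def)

lemma mono_eval_add: "mono_eval a (m + n) = mono_eval a m * mono_eval a n"
  by (simp add: mono_eval_def lookup_add power_add prod.distrib)

lemma mono_eval_single: "mono_eval a (Poly_Mapping.single i n) = a i ^ n"
proof -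
  have "mono_eval a (Poly_Mapping.single i n) = (\<Prod>j\<in>UNIV. if j = i then a i ^ n else 1)"
    unfolding mono_eval_def by (rule prod.cong) (auto simp: lookup_single when_def)
  thus ?thesis by simp
qed

lemma peval_superset:
  assumes "finite S" "Poly_Mapping.keys p \<subseteq> S"
  shows "peval a p = (\<Sum>m\<in>S. Poly_Mapping.lookup p m * mono_eval a m)"
  unfolding peval_def by (rule sum.mono_neutral_left) (use assms in \<open>auto simp: in_keys_iff\<close>)

lemma peval_add: "peval a (p + q) = peval a p + peval a q"
proof -
  let ?S = "Poly_Mapping.keys p \<union> Poly_Mapping.keys q"
  have "peval a (p + q) = (\<Sum>m\<in>?S. Poly_Mapping.lookup (p + q) m * mono_eval a m)"
    by (rule peval_superset) (auto simp: keys_add)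
  also have "\<dots> = (\<Sum>m\<in>?S. Poly_Mapping.lookup p m * mono_eval a m)
                 + (\<Sum>m\<in>?S. Poly_Mapping.lookup q m * mono_eval a m)"
    by (simp add: lookup_add distrib_right sum.distrib)
  also have "\<dots> = peval a p + peval a q"
    by (simp add: peval_superset[of ?S p] peval_superset[of ?S q])
  finally show ?thesis .
qed

lemma peval_single: "peval a (Poly_Mapping.single m c) = c * mono_eval a m"
  by (simp add: peval_superset[of "{m}"])

lemma peval_0 [simp]: "peval a 0 = 0"
  by (simp add: peval_def)

lemma peval_sum: "peval a (sum f S) = (\<Sum>s\<in>S. peval a (f s))"
  by (induction S rule: infinite_finite_induct) (auto simp: peval_add)

lemma poly3_sum_singles:
  "p = (\<Sum>m\<in>Poly_Mapping.keys p. Poly_Mapping.single m (Poly_Mapping.lookup p m))"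
  by (rule poly_mapping_eqI)
    (auto simp: lookup_sum lookup_single when_def in_keys_iff if_distrib sum.delta cong: if_cong)

lemma peval_mult: "peval a (p * q) = peval a p * peval a q"
proof -
  let ?s = "\<lambda>p m. Poly_Mapping.single m (Poly_Mapping.lookup p m)"
  have "p * q = (\<Sum>m\<in>Poly_Mapping.keys p. ?s p m) * (\<Sum>n\<in>Poly_Mapping.keys q. ?s q n)"
    using poly3_sum_singles[of p] poly3_sum_singles[of q] by simp
  also have "\<dots> = (\<Sum>m\<in>Poly_Mapping.keys p. \<Sum>n\<in>Poly_Mapping.keys q. ?s p m * ?s q n)"
    by (rule sum_product)
  finally have pq: "p * q = \<dots>" .
  have "peval a (p * q) = (\<Sum>m\<in>Poly_Mapping.keys p. \<Sum>n\<in>Poly_Mapping.keys q.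
      (Poly_Mapping.lookup p m * mono_eval a m) * (Poly_Mapping.lookup q n * mono_eval a n))"
    unfolding pq by (simp add: peval_sum mult_single peval_single mono_eval_add mult_ac)
  also have "\<dots> = peval a p * peval a q"
    unfolding peval_def by (rule sum_product[symmetric])
  finally show ?thesis .
qed

lemma peval_1 [simp]: "peval a 1 = 1"
  using peval_single[of a 0 1] by simp

lemma peval_pvar [simp]: "peval a (pvar i) = a i"
  by (simp add: pvar_def peval_single mono_eval_single)

lemma not_sphere_poly_dvd_1: "\<not> sphere_poly dvd (1 :: 'k::field poly3)"
proof
  assume "sphere_poly dvd (1 :: 'k poly3)"
  then obtain q :: "'k poly3" where q: "1 = sphere_poly * q" ..
  define a :: "3 \<Rightarrow> 'k" where "a = (\<lambda>i. if i = 1 then 1 else 0)"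
  have "(sphere_poly :: 'k poly3) + 1 = pvar 1 ^ 2 + pvar 2 ^ 2 + pvar 3 ^ 2"
    by (simp add: sphere_poly_def)
  hence "peval a sphere_poly + peval a 1 = peval a (pvar 1 ^ 2 + pvar 2 ^ 2 + pvar 3 ^ 2)"
    by (metis peval_add)
  hence "peval a sphere_poly = 0"
    by (simp add: peval_add power2_eq_square peval_mult a_def)
  hence "peval a (sphere_poly * q) = 0" by (simp add: peval_mult)
  thus False using q[symmetric] by simp
qed

quotient_type (overloaded) 'k sphere_ring = "'k::field poly3" / sphere_eq
  by (rule equivp_sphere_eq)

instantiation sphere_ring :: (field) comm_ring_1
begin

lift_definition zero_sphere_ring :: "'a sphere_ring" is 0 .
lift_definition one_sphere_ring :: "'a sphere_ring" is 1 .
lift_definition plus_sphere_ring :: "'a sphere_ring \<Rightarrow> 'a sphere_ring \<Rightarrow> 'a sphere_ring" is "(+)"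
  unfolding sphere_eq_def by (metis add_diff_add dvd_add)
lift_definition uminus_sphere_ring :: "'a sphere_ring \<Rightarrow> 'a sphere_ring" is uminus
  unfolding sphere_eq_def by (metis dvd_minus_iff minus_diff_minus)
lift_definition minus_sphere_ring :: "'a sphere_ring \<Rightarrow> 'a sphere_ring \<Rightarrow> 'a sphere_ring" is "(-)"
proof -
  fix p p' q q' :: "'a poly3"
  assume "sphere_eq p p'" "sphere_eq q q'"
  moreover have "(p - q) - (p' - q') = (p - p') - (q - q')" by (simp add: algebra_simps)
  ultimately show "sphere_eq (p - q) (p' - q')"
    unfolding sphere_eq_def by (simp only: dvd_diff)
qed
lift_definition times_sphere_ring :: "'a sphere_ring \<Rightarrow> 'a sphere_ring \<Rightarrow> 'a sphere_ring" is "(*)"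
proof -
  fix p p' q q' :: "'a poly3"
  assume "sphere_eq p p'" "sphere_eq q q'"
  moreover have "p * q - p' * q' = (p - p') * q + p' * (q - q')" by (simp add: algebra_simps)
  ultimately show "sphere_eq (p * q) (p' * q')"
    unfolding sphere_eq_def by (simp add: dvd_add)
qed

instance
proof
  show "(0 :: 'a sphere_ring) \<noteq> 1"
  proof (transfer, rule notI)
    assume "sphere_eq 0 (1 :: 'a poly3)"
    hence "sphere_poly dvd - (1 :: 'a poly3)" by (simp only: sphere_eq_def diff_0)
    hence "sphere_poly dvd (1 :: 'a poly3)" by (simp only: dvd_minus_iff)
    thus False using not_sphere_poly_dvd_1 by blast
  qed
qed (transfer; simp add: sphere_eq_def algebra_simps)+

end

lift_definition sconst :: "'k::field \<Rightarrow> 'k sphere_ring" is pconst .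

lift_definition svar :: "3 \<Rightarrow> 'k::field sphere_ring" is pvar .


section \<open>Derivations and Lie--Rinehart cohomology\<close>

definition derivations :: "('k::field sphere_ring \<Rightarrow> 'k sphere_ring) set" where
  "derivations = {\<delta>. (\<forall>a b. \<delta> (a + b) = \<delta> a + \<delta> b) \<and>
                     (\<forall>c a. \<delta> (sconst c * a) = sconst c * \<delta> a) \<and>
                     (\<forall>a b. \<delta> (a * b) = a * \<delta> b + b * \<delta> a)}"

definition lie_bracket :: "('a \<Rightarrow> 'a::ab_group_add) \<Rightarrow> ('a \<Rightarrow> 'a) \<Rightarrow> ('a \<Rightarrow> 'a)" where
  "lie_bracket \<delta> \<eta> = (\<lambda>a. \<delta> (\<eta> a) - \<eta> (\<delta> a))"

text \<open>In the following \<open>L\<close> is a set of additive maps on a commutative ring that is closed under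
  pointwise addition, multiplication by ring elements, and brackets; it is used for
  \<open>L = derivations\<close>. The elements of \<open>Hom(\<And>\<^sup>n L, A)\<close> are the alternating multilinear maps
  \<open>L\<^sup>n \<rightarrow> A\<close>, here functions on lists of length \<open>n\<close>. They are required to
  be zero outside \<open>L\<^sup>n\<close>, so that equality of cochains is equality of functions.\<close>

definition tuples :: "('a \<Rightarrow> 'a) set \<Rightarrow> nat \<Rightarrow> ('a \<Rightarrow> 'a) list set" where
  "tuples L n = {\<delta>s. set \<delta>s \<subseteq> L \<and> length \<delta>s = n}"

definition cochains ::
  "('a::comm_ring_1 \<Rightarrow> 'a) set \<Rightarrow> nat \<Rightarrow> (('a \<Rightarrow> 'a) list \<Rightarrow> 'a) set" where
  "cochains L n = {f.
     (\<forall>\<delta>s. \<delta>s \<notin> tuples L n \<longrightarrow> f \<delta>s = 0) \<and>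
     (\<forall>\<delta>s\<in>tuples L n. \<forall>i<n. \<forall>\<delta>\<in>L. \<forall>\<eta>\<in>L.
        f (\<delta>s[i := (\<lambda>a. \<delta> a + \<eta> a)]) = f (\<delta>s[i := \<delta>]) + f (\<delta>s[i := \<eta>])) \<and>
     (\<forall>\<delta>s\<in>tuples L n. \<forall>i<n. \<forall>\<delta>\<in>L. \<forall>c.
        f (\<delta>s[i := (\<lambda>a. c * \<delta> a)]) = c * f (\<delta>s[i := \<delta>])) \<and>
     (\<forall>\<delta>s\<in>tuples L n. \<forall>i<n. \<forall>j<n. i \<noteq> j \<longrightarrow> \<delta>s ! i = \<delta>s ! j \<longrightarrow> f \<delta>s = 0)}"

definition delete_at :: "nat \<Rightarrow> 'b list \<Rightarrow> 'b list" where
  "delete_at i xs = take i xs @ drop (Suc i) xs"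

text \<open>Deleting entry \<open>j\<close> before entry \<open>i < j\<close> leaves the position of entry \<open>i\<close> unchanged.\<close>

definition ce_diff ::
  "('a::comm_ring_1 \<Rightarrow> 'a) set \<Rightarrow> nat \<Rightarrow> (('a \<Rightarrow> 'a) list \<Rightarrow> 'a) \<Rightarrow> (('a \<Rightarrow> 'a) list \<Rightarrow> 'a)" where
  "ce_diff L n f = (\<lambda>\<delta>s. if \<delta>s \<in> tuples L (Suc n) then
       (\<Sum>i\<le>n. (-1) ^ i * (\<delta>s ! i) (f (delete_at i \<delta>s)))
     + (\<Sum>j\<le>n. \<Sum>i<j. (-1) ^ (i + j)
          * f (lie_bracket (\<delta>s ! i) (\<delta>s ! j) # delete_at i (delete_at j \<delta>s)))
     else 0)"

definition cocycles ::
  "('a::comm_ring_1 \<Rightarrow> 'a) set \<Rightarrow> nat \<Rightarrow> (('a \<Rightarrow> 'a) list \<Rightarrow> 'a) set" where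
  "cocycles L n = {f \<in> cochains L n. ce_diff L n f = (\<lambda>_. 0)}"

definition coboundaries ::
  "('a::comm_ring_1 \<Rightarrow> 'a) set \<Rightarrow> nat \<Rightarrow> (('a \<Rightarrow> 'a) list \<Rightarrow> 'a) set" where
  "coboundaries L n =
     (case n of 0 \<Rightarrow> {\<lambda>_. 0} | Suc m \<Rightarrow> ce_diff L m ` cochains L m)"

definition cocycle_group ::
  "('a::comm_ring_1 \<Rightarrow> 'a) set \<Rightarrow> nat \<Rightarrow> (('a \<Rightarrow> 'a) list \<Rightarrow> 'a) monoid" where
  "cocycle_group L n =
     \<lparr>carrier = cocycles L n, mult = (\<lambda>f g \<delta>s. f \<delta>s + g \<delta>s), one = (\<lambda>_. 0)\<rparr>"

definition lr_cohomology ::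
  "('a::comm_ring_1 \<Rightarrow> 'a) set \<Rightarrow> nat \<Rightarrow> (('a \<Rightarrow> 'a) list \<Rightarrow> 'a) set monoid" where
  "lr_cohomology L n = cocycle_group L n Mod coboundaries L n"

definition cohomology_class ::
  "('a::comm_ring_1 \<Rightarrow> 'a) set \<Rightarrow> nat \<Rightarrow> (('a \<Rightarrow> 'a) list \<Rightarrow> 'a) \<Rightarrow> (('a \<Rightarrow> 'a) list \<Rightarrow> 'a) set"
  where "cohomology_class L n f = coboundaries L n #>\<^bsub>cocycle_group L n\<^esub> f"


section \<open>The trace on a finitely generated projective module\<close>

definition projective_basis ::
  "('a::comm_ring_1 \<Rightarrow> 'm::ab_group_add \<Rightarrow> 'm) \<Rightarrow> ('m \<times> ('m \<Rightarrow> 'a)) list \<Rightarrow> bool" where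
  "projective_basis scale bs \<longleftrightarrow>
     (\<forall>(e, f)\<in>set bs. module_hom scale (*) f) \<and>
     (\<forall>v. (\<Sum>(e, f)\<leftarrow>bs. scale (f v) e) = v)"

text \<open>The trace of an endomorphism \<open>\<phi>\<close> is \<open>\<Sum>\<^sub>i f\<^sub>i(\<phi>(e\<^sub>i))\<close>, which is the same for every
  projective basis.\<close>

definition proj_trace ::
  "('a::comm_ring_1 \<Rightarrow> 'm::ab_group_add \<Rightarrow> 'm) \<Rightarrow> ('m \<Rightarrow> 'm) \<Rightarrow> 'a" where
  "proj_trace scale \<phi> =
     (THE t. \<exists>bs. projective_basis scale bs \<and> t = (\<Sum>(e, f)\<leftarrow>bs. f (\<phi> e)))"


section \<open>Kaehler differentials\<close>

text \<open>The module of Kaehler differentials is the free module on symbols \<open>d a\<close>, \<open>a\<close> in the ring,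
  modulo the relations that make \<open>d\<close> a \<open>K\<close>-linear derivation. The symbol \<open>d a\<close>
  is \<open>Poly_Mapping.single a 1\<close>; the ring multiplication that \<open>\<Rightarrow>\<^sub>0\<close> carries plays no role here.\<close>

definition free_scale :: "'a::comm_ring_1 \<Rightarrow> ('b \<Rightarrow>\<^sub>0 'a) \<Rightarrow> ('b \<Rightarrow>\<^sub>0 'a)" where
  "free_scale c u = Poly_Mapping.map ((*) c) u"

lemma lookup_free_scale [simp]:
  "Poly_Mapping.lookup (free_scale c u) b = c * Poly_Mapping.lookup u b"
  by (simp add: free_scale_def Poly_Mapping.map.rep_eq when_def)

interpretation free_module: module free_scale
  by unfold_locales (auto intro!: poly_mapping_eqI simp: lookup_add algebra_simps)

definition symb :: "'a \<Rightarrow> ('a \<Rightarrow>\<^sub>0 'a::comm_ring_1)" where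
  "symb a = Poly_Mapping.single a 1"

definition kaehler_relations :: "('k::field sphere_ring \<Rightarrow>\<^sub>0 'k sphere_ring) set" where
  "kaehler_relations =
     {symb (a + b) - symb a - symb b | a b. True} \<union>
     {symb (sconst c * a) - free_scale (sconst c) (symb a) | c a. True} \<union>
     {symb (a * b) - free_scale a (symb b) - free_scale b (symb a) | a b. True}"

definition kaehler_eq ::
  "('k::field sphere_ring \<Rightarrow>\<^sub>0 'k sphere_ring) \<Rightarrow> ('k sphere_ring \<Rightarrow>\<^sub>0 'k sphere_ring) \<Rightarrow> bool" where
  "kaehler_eq u v \<longleftrightarrow> u - v \<in> module.span free_scale kaehler_relations"

lemma equivp_kaehler_eq: "equivp (kaehler_eq :: ('k::field sphere_ring \<Rightarrow>\<^sub>0 _) \<Rightarrow> _)"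
proof (rule equivpI)
  show "reflp (kaehler_eq :: ('k sphere_ring \<Rightarrow>\<^sub>0 _) \<Rightarrow> _)"
    by (simp add: reflp_def kaehler_eq_def free_module.span_zero)
  show "symp (kaehler_eq :: ('k sphere_ring \<Rightarrow>\<^sub>0 _) \<Rightarrow> _)"
    unfolding symp_def kaehler_eq_def by (metis free_module.span_neg minus_diff_eq)
  show "transp (kaehler_eq :: ('k sphere_ring \<Rightarrow>\<^sub>0 _) \<Rightarrow> _)"
  proof (rule transpI)
    fix u v w :: "'k sphere_ring \<Rightarrow>\<^sub>0 'k sphere_ring"
    assume "kaehler_eq u v" "kaehler_eq v w"
    hence "(u - v) + (v - w) \<in> module.span free_scale kaehler_relations"
      unfolding kaehler_eq_def by (rule free_module.span_add)
    thus "kaehler_eq u w" by (simp add: kaehler_eq_def)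
  qed
qed

quotient_type (overloaded) 'k kaehler = "'k::field sphere_ring \<Rightarrow>\<^sub>0 'k sphere_ring" / kaehler_eq
  by (rule equivp_kaehler_eq)

instantiation kaehler :: (field) ab_group_add
begin

lift_definition zero_kaehler :: "'a kaehler" is 0 .
lift_definition plus_kaehler :: "'a kaehler \<Rightarrow> 'a kaehler \<Rightarrow> 'a kaehler" is "(+)"
proof -
  fix u u' v v' :: "'a sphere_ring \<Rightarrow>\<^sub>0 'a sphere_ring"
  assume "kaehler_eq u u'" "kaehler_eq v v'"
  hence "(u - u') + (v - v') \<in> module.span free_scale kaehler_relations"
    unfolding kaehler_eq_def by (rule free_module.span_add)
  thus "kaehler_eq (u + v) (u' + v')" by (simp only: kaehler_eq_def add_diff_add)
qed
lift_definition uminus_kaehler :: "'a kaehler \<Rightarrow> 'a kaehler" is uminus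
proof -
  fix u u' :: "'a sphere_ring \<Rightarrow>\<^sub>0 'a sphere_ring"
  assume "kaehler_eq u u'"
  hence "- (u - u') \<in> module.span free_scale kaehler_relations"
    unfolding kaehler_eq_def by (rule free_module.span_neg)
  thus "kaehler_eq (- u) (- u')" by (simp only: kaehler_eq_def minus_diff_minus)
qed
lift_definition minus_kaehler :: "'a kaehler \<Rightarrow> 'a kaehler \<Rightarrow> 'a kaehler" is "(-)"
proof -
  fix u u' v v' :: "'a sphere_ring \<Rightarrow>\<^sub>0 'a sphere_ring"
  assume "kaehler_eq u u'" "kaehler_eq v v'"
  hence "(u - u') - (v - v') \<in> module.span free_scale kaehler_relations"
    unfolding kaehler_eq_def by (rule free_module.span_diff)
  moreover have "(u - u') - (v - v') = (u - v) - (u' - v')" by (simp add: algebra_simps)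
  ultimately show "kaehler_eq (u - v) (u' - v')" by (simp only: kaehler_eq_def)
qed

instance
  by standard (transfer; simp add: kaehler_eq_def free_module.span_zero algebra_simps)+

end

text \<open>The next two liftings concern only the quotient \<open>kaehler\<close>, so \<open>sphere_ring\<close> must not be
  unfolded to polynomials.\<close>

lifting_update sphere_ring.lifting
lifting_forget sphere_ring.lifting

lift_definition kscale :: "'k::field sphere_ring \<Rightarrow> 'k kaehler \<Rightarrow> 'k kaehler" is free_scale
proof -
  fix c :: "'k sphere_ring" and u u' :: "'k sphere_ring \<Rightarrow>\<^sub>0 'k sphere_ring"
  assume "kaehler_eq u u'"
  hence "free_scale c (u - u') \<in> module.span free_scale kaehler_relations"
    unfolding kaehler_eq_def by (rule free_module.span_scale)
  thus "kaehler_eq (free_scale c u) (free_scale c u')"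
    by (simp only: kaehler_eq_def free_module.scale_right_diff_distrib)
qed

interpretation kaehler_module: module kscale
  by unfold_locales
    (transfer; simp add: kaehler_eq_def free_module.span_zero free_module.scale_right_distrib
      free_module.scale_left_distrib)+

lift_definition kd :: "'k::field sphere_ring \<Rightarrow> 'k kaehler" is symb .

unbundle sphere_ring.lifting

lemma svar_sphere: "svar 1 * svar 1 + svar 2 * svar 2 + svar 3 * svar 3 = (1 :: 'k::field sphere_ring)"
  by transfer (simp add: sphere_eq_def sphere_poly_def power2_eq_square)



section \<open>The coordinate maps, curvature and first Chern class\<close>

text \<open>The elements \<open>kd (svar j)\<close> generate the module, so there is at most one such linear map; it
  exists in every characteristic, since \<open>\<Sum>\<^sub>j (\<delta>\<^sub>i\<^sub>j - x\<^sub>ix\<^sub>j) \<partial>\<^sub>j\<close> is a derivation of the polynomial ring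
  that maps the sphere polynomial into the ideal it generates.\<close>

definition xi :: "3 \<Rightarrow> 'k::field kaehler \<Rightarrow> 'k sphere_ring" where
  "xi i = (THE f. module_hom kscale (*) f \<and>
             (\<forall>j. f (kd (svar j)) = (if i = j then 1 else 0) - svar i * svar j))"

definition curvature ::
  "(('a::ab_group_add \<Rightarrow> 'a) \<Rightarrow> 'm::ab_group_add \<Rightarrow> 'm) \<Rightarrow> ('a \<Rightarrow> 'a) \<Rightarrow> ('a \<Rightarrow> 'a) \<Rightarrow> 'm \<Rightarrow> 'm" where
  "curvature nabla \<delta> \<eta> = (\<lambda>\<omega>. nabla \<delta> (nabla \<eta> \<omega>) - nabla \<eta> (nabla \<delta> \<omega>) - nabla (lie_bracket \<delta> \<eta>) \<omega>)"

definition trace_curvature ::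
  "(('k::field sphere_ring \<Rightarrow> 'k sphere_ring) \<Rightarrow> 'k kaehler \<Rightarrow> 'k kaehler) \<Rightarrow>
   ('k sphere_ring \<Rightarrow> 'k sphere_ring) list \<Rightarrow> 'k sphere_ring" where
  "trace_curvature nabla = (\<lambda>\<delta>s. if \<delta>s \<in> tuples derivations 2
     then proj_trace kscale (curvature nabla (\<delta>s ! 0) (\<delta>s ! 1)) else 0)"

text \<open>The first Chern class of the module of Kaehler differentials, computed from a connection.\<close>

definition c1_class ::
  "(('k::field sphere_ring \<Rightarrow> 'k sphere_ring) \<Rightarrow> 'k kaehler \<Rightarrow> 'k kaehler) \<Rightarrow>
   (('k sphere_ring \<Rightarrow> 'k sphere_ring) list \<Rightarrow> 'k sphere_ring) set" where
  "c1_class nabla = cohomology_class derivations 2 (trace_curvature nabla)"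

end

theory Submission
  imports Defs
begin

text \<open>Since \<open>\<Sum>\<^sub>i x\<^sub>i dx\<^sub>i = 0\<close>, the maps \<open>\<xi>\<^sub>i\<close> embed the differentials into \<open>A\<^sup>3\<close> as the vectors \<open>w\<close> orthogonal
  to \<open>x\<close>, and a derivation \<open>\<delta>\<close> is given by the vector \<open>\<delta>x\<close>, which is also orthogonal to \<open>x\<close>. The
  connection becomes the orthogonal projection of the componentwise derivative, so the curvature is
  that of the round sphere, \<open>w \<mapsto> \<langle>\<eta>x, w\<rangle> \<delta>x - \<langle>\<delta>x, w\<rangle> \<eta>x\<close>. Its trace
  \<open>\<langle>\<eta>x, \<delta>x\<rangle> - \<langle>\<delta>x, \<eta>x\<rangle>\<close> vanishes, so already the cocycle representing the Chern class is zero. For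
  the projections of the first two coordinate fields, the second coordinate of the curvature applied
  to \<open>dx\<^sub>1\<close> is \<open>-x\<^sub>3\<^sup>2\<close>, which does not vanish at the point \<open>(0, 0, 1)\<close>.\<close>

section \<open>Derivations of the sphere ring\<close>

definition partial_deriv :: "3 \<Rightarrow> 'k::field poly3 \<Rightarrow> 'k poly3" where
  "partial_deriv j p = (\<Sum>m\<in>Poly_Mapping.keys p.
     Poly_Mapping.single (m - Poly_Mapping.single j 1)
       (Poly_Mapping.lookup p m * of_nat (Poly_Mapping.lookup m j)))"

lemma partial_deriv_superset:
  assumes "finite S" "Poly_Mapping.keys p \<subseteq> S"
  shows "partial_deriv j p = (\<Sum>m\<in>S.
     Poly_Mapping.single (m - Poly_Mapping.single j 1)
       (Poly_Mapping.lookup p m * of_nat (Poly_Mapping.lookup m j)))"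
  unfolding partial_deriv_def
  by (rule sum.mono_neutral_left) (use assms in \<open>auto simp: in_keys_iff\<close>)

lemma partial_deriv_add: "partial_deriv j (p + q) = partial_deriv j p + partial_deriv j q"
proof -
  let ?S = "Poly_Mapping.keys p \<union> Poly_Mapping.keys q"
  have "Poly_Mapping.keys (p + q) \<subseteq> ?S" by (rule keys_add)
  then show ?thesis
    by (simp add: partial_deriv_superset[of ?S] lookup_add distrib_right single_add sum.distrib)
qed

lemma partial_deriv_single:
  "partial_deriv j (Poly_Mapping.single m c) =
     Poly_Mapping.single (m - Poly_Mapping.single j 1) (c * of_nat (Poly_Mapping.lookup m j))"
  by (simp add: partial_deriv_superset[of "{m}"])

lemma partial_deriv_0 [simp]: "partial_deriv j 0 = 0"
  by (simp add: partial_deriv_def)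

lemma partial_deriv_sum: "partial_deriv j (sum f S) = (\<Sum>s\<in>S. partial_deriv j (f s))"
  by (induction S rule: infinite_finite_induct) (auto simp: partial_deriv_add)

lemma partial_deriv_pvar: "partial_deriv j (pvar i) = (if i = j then 1 else 0)"
  by (simp add: pvar_def partial_deriv_single lookup_single when_def)

lemma partial_deriv_pconst: "partial_deriv j (pconst c) = 0"
  by (simp add: pconst_def partial_deriv_single)

text \<open>Subtraction of exponents is truncated at zero, so it commutes with addition only where
  the subtracted variable really occurs.\<close>

lemma add_minus_single:
  fixes m n :: "'a \<Rightarrow>\<^sub>0 nat"
  assumes "Poly_Mapping.lookup n j \<noteq> 0"
  shows "m + (n - Poly_Mapping.single j 1) = m + n - Poly_Mapping.single j 1"
  by (rule poly_mapping_eqI)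
    (use assms in \<open>auto simp: lookup_add lookup_minus lookup_single when_def\<close>)

lemma partial_deriv_mult_single:
  fixes c d :: "'k::field"
  defines "s \<equiv> Poly_Mapping.single"
  shows "partial_deriv j (s m c * s n d) =
    s m c * partial_deriv j (s n d) + s n d * partial_deriv j (s m c)"
proof -
  let ?e = "Poly_Mapping.single j 1 :: 3 \<Rightarrow>\<^sub>0 nat"
  \<comment> \<open>If \<open>n\<close> does not contain the variable \<open>j\<close>, the two
    exponents may differ, but then both coefficients are zero.\<close>
  have shift: "s (m + (n - ?e)) (c * (d * of_nat (Poly_Mapping.lookup n j)))
      = s (m + n - ?e) (c * (d * of_nat (Poly_Mapping.lookup n j)))" for m n and c d :: 'k
    using add_minus_single[of n j m] by (cases "Poly_Mapping.lookup n j = 0") (auto simp: s_def)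
  show ?thesis
    unfolding s_def mult_single partial_deriv_single
    using shift[of m n c d] shift[of n m d c]
    by (simp add: s_def single_add[symmetric] lookup_add algebra_simps)
qed

lemma partial_deriv_mult:
  "partial_deriv j (p * q) = p * partial_deriv j q + q * partial_deriv j p"
proof -
  let ?s = "\<lambda>p m. Poly_Mapping.single m (Poly_Mapping.lookup p m)"
  let ?p = "\<Sum>m\<in>Poly_Mapping.keys p. ?s p m" and ?q = "\<Sum>m\<in>Poly_Mapping.keys q. ?s q m"
  have "partial_deriv j (?p * ?q) = ?p * partial_deriv j ?q + ?q * partial_deriv j ?p"
    unfolding sum_product partial_deriv_sum partial_deriv_mult_single sum.distrib
    \<comment> \<open>The double sums of the terms \<open>q * partial_deriv j p\<close> on the two
      sides differ only in the order of summation.\<close>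
    by (subst (4) sum.swap) simp
  then show ?thesis
    using poly3_sum_singles[of p] poly3_sum_singles[of q] by simp
qed

section \<open>Tangential projections of the coordinate fields\<close>

lemma UNIV_3: "(UNIV :: 3 set) = {1, 2, 3}"
proof -
  have "card {1, 2, 3 :: 3} = CARD(3)" by simp
  then show ?thesis by (metis card_subset_eq finite subset_UNIV)
qed

lemma sum_3: "sum f (UNIV :: 3 set) = f 1 + f 2 + f 3"
  unfolding UNIV_3 by (simp add: add.assoc)

text \<open>This is the vector field \<open>e_i - x_i x\<close>, on the sphere the orthogonal
  projection of the coordinate field \<open>e_i\<close> to the tangent plane. Its coefficients are
  the values prescribed for \<open>xi i\<close> on the generators.\<close>

definition tangent_poly :: "3 \<Rightarrow> 'k::field poly3 \<Rightarrow> 'k poly3" where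
  "tangent_poly i p = (\<Sum>j\<in>UNIV. ((if i = j then 1 else 0) - pvar i * pvar j) * partial_deriv j p)"

lemma tangent_poly_add: "tangent_poly i (p + q) = tangent_poly i p + tangent_poly i q"
  by (simp add: tangent_poly_def partial_deriv_add distrib_left sum.distrib)

lemma tangent_poly_diff: "tangent_poly i (p - q) = tangent_poly i p - tangent_poly i q"
  using tangent_poly_add[of i "p - q" q] by simp

lemma tangent_poly_mult:
  "tangent_poly i (p * q) = p * tangent_poly i q + q * tangent_poly i p"
  unfolding tangent_poly_def partial_deriv_mult sum_distrib_left sum.distrib[symmetric]
  by (rule sum.cong) (simp_all only: distrib_left distrib_right mult_ac)

text \<open>With \<open>s = x_1^2 + x_2^2 + x_3^2\<close>, the field sends \<open>s - 1\<close> to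
  \<open>2 x_i - 2 x_i s\<close>. The result is a multiple of \<open>s - 1\<close>, hence the
  derivation descends to the quotient ring.\<close>

lemma tangent_poly_sphere_poly: "tangent_poly i sphere_poly = - 2 * pvar i * sphere_poly"
proof -
  \<comment> \<open>The form with a sum of products and a \<open>pconst\<close> lets the sum,
    product and constant rules for \<open>partial_deriv\<close> act directly.\<close>
  have sphere: "(sphere_poly :: 'a poly3) = (\<Sum>i\<in>UNIV. pvar i * pvar i) + pconst (- 1)"
    by (simp add: sphere_poly_def sum_3 power2_eq_square pconst_def single_uminus)
  have pd: "partial_deriv j sphere_poly = 2 * (pvar j :: 'a poly3)" for j
  proof -
    have "partial_deriv j (sphere_poly :: 'a poly3) = (\<Sum>i\<in>UNIV. if i = j then 2 * pvar i else 0)"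
      unfolding sphere partial_deriv_add partial_deriv_sum partial_deriv_mult partial_deriv_pvar
        partial_deriv_pconst add_0_right by (rule sum.cong) auto
    then show ?thesis by simp
  qed
  have "tangent_poly i sphere_poly =
      (\<Sum>j\<in>UNIV. (if j = i then 2 * pvar i else 0) - 2 * pvar i * (pvar j * (pvar j :: 'a poly3)))"
    unfolding tangent_poly_def pd by (rule sum.cong) (auto simp: algebra_simps)
  also have "\<dots> = 2 * pvar i - 2 * pvar i * (\<Sum>j\<in>UNIV. pvar j * (pvar j :: 'a poly3))"
    unfolding sum_subtractf sum_distrib_left[symmetric] by simp
  finally show ?thesis
    by (simp add: sphere_poly_def sum_3 power2_eq_square algebra_simps)
qed

lift_definition tangent_deriv :: "3 \<Rightarrow> 'k::field sphere_ring \<Rightarrow> 'k sphere_ring" is tangent_poly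
proof -
  fix i and p q :: "'k poly3"
  assume "sphere_eq p q"
  then obtain r where "p - q = sphere_poly * r" unfolding sphere_eq_def ..
  then have "tangent_poly i p - tangent_poly i q =
      sphere_poly * (tangent_poly i r - 2 * pvar i * r)"
    by (simp add: tangent_poly_diff[symmetric] tangent_poly_mult tangent_poly_sphere_poly
        algebra_simps)
  then show "sphere_eq (tangent_poly i p) (tangent_poly i q)"
    by (simp add: sphere_eq_def)
qed

lemma tangent_deriv_derivation: "tangent_deriv i \<in> derivations"
proof -
  have c: "tangent_poly i (pconst c) = 0" for c :: 'a
    by (simp add: tangent_poly_def partial_deriv_pconst)
  have add: "tangent_deriv i (a + b) = tangent_deriv i a + tangent_deriv i b" for a b :: "'a sphere_ring"
    by (induction a rule: sphere_ring.abs_induct, induction b rule: sphere_ring.abs_induct)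
      (simp only: tangent_deriv.abs_eq plus_sphere_ring.abs_eq tangent_poly_add)
  have mult: "tangent_deriv i (a * b) = a * tangent_deriv i b + b * tangent_deriv i a"
    for a b :: "'a sphere_ring"
    by (induction a rule: sphere_ring.abs_induct, induction b rule: sphere_ring.abs_induct)
      (simp only: tangent_deriv.abs_eq plus_sphere_ring.abs_eq times_sphere_ring.abs_eq
        tangent_poly_mult)
  \<comment> \<open>Vanishing on constants turns the Leibniz rule into linearity over the
    field.\<close>
  have "tangent_deriv i (sconst c) = 0" for c :: 'a
    by (simp only: sconst.abs_eq tangent_deriv.abs_eq c zero_sphere_ring.abs_eq)
  with add mult show ?thesis by (simp add: derivations_def)
qed

lemma tangent_deriv_svar:
  "tangent_deriv i (svar j) = (if i = j then 1 else 0) - svar i * svar j"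
proof -
  have "tangent_poly i (pvar j) = (if i = j then 1 else 0) - pvar i * (pvar j :: 'a poly3)"
    by (simp add: tangent_poly_def partial_deriv_pvar if_distrib[of "(*) _"] cong: if_cong)
  then show ?thesis
    by (cases "i = j")
      (simp_all only: simp_thms if_True if_False svar.abs_eq tangent_deriv.abs_eq minus_sphere_ring.abs_eq
        times_sphere_ring.abs_eq one_sphere_ring.abs_eq zero_sphere_ring.abs_eq)
qed

section \<open>Generators of the polynomial ring and of the sphere ring\<close>

lemma poly3_induct [case_names const var add mult]:
  assumes "\<And>c. P (pconst c)" "\<And>i. P (pvar i)"
    and add: "\<And>p q. P p \<Longrightarrow> P q \<Longrightarrow> P (p + q)" and mult: "\<And>p q. P p \<Longrightarrow> P q \<Longrightarrow> P (p * q)"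
  shows "P (p :: 'k::field poly3)"
proof -
  have const1: "P 1" using assms(1)[of 1] by (simp add: pconst_def)
  have const0: "P 0" using assms(1)[of 0] by (simp add: pconst_def)
  have pow: "P (q ^ n)" if "P q" for q n
    by (induction n) (auto intro: that const1 mult)
  have pvar_pow: "pvar i ^ n = Poly_Mapping.single (Poly_Mapping.single i n) (1 :: 'k)" for i n
    by (induction n) (simp_all add: pvar_def mult_single single_add[symmetric])
  have "P (Poly_Mapping.single m c)" for m c
  proof -
    \<comment> \<open>Splitting the exponent into its three coordinates writes the monomial as a
      constant times powers of the variables.\<close>
    have "m = Poly_Mapping.single 1 (Poly_Mapping.lookup m 1)
        + Poly_Mapping.single 2 (Poly_Mapping.lookup m 2)
        + Poly_Mapping.single 3 (Poly_Mapping.lookup m 3)" (is "_ = ?m")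
    proof (rule poly_mapping_eqI)
      fix i :: 3
      have "i = 1 \<or> i = 2 \<or> i = 3" using UNIV_3 by auto
      then show "Poly_Mapping.lookup m i = Poly_Mapping.lookup ?m i"
        by (auto simp: lookup_add lookup_single when_def)
    qed
    then have "Poly_Mapping.single m c = pconst c * pvar 1 ^ Poly_Mapping.lookup m 1
        * pvar 2 ^ Poly_Mapping.lookup m 2 * pvar 3 ^ Poly_Mapping.lookup m 3"
      by (simp add: pvar_pow pconst_def mult_single)
    then show ?thesis by (simp add: assms pow)
  qed
  then have "P (\<Sum>m\<in>S. Poly_Mapping.single m (Poly_Mapping.lookup p m))" for S
    by (induction S rule: infinite_finite_induct) (simp_all add: add const0)
  then show ?thesis using poly3_sum_singles[of p] by metis
qed

lemma sphere_ring_induct [case_names const var add mult]: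
  assumes "\<And>c. P (sconst c)" "\<And>i. P (svar i)"
    and "\<And>a b. P a \<Longrightarrow> P b \<Longrightarrow> P (a + b)" "\<And>a b. P a \<Longrightarrow> P b \<Longrightarrow> P (a * b)"
  shows "P (a :: 'k::field sphere_ring)"
proof -
  have "P (abs_sphere_ring p)" for p
    by (induction p rule: poly3_induct)
      (use assms in \<open>simp_all add: sconst.abs_eq[symmetric] svar.abs_eq[symmetric]
        plus_sphere_ring.abs_eq[symmetric] times_sphere_ring.abs_eq[symmetric]\<close>)
  then show ?thesis by (induction a rule: sphere_ring.abs_induct)
qed


section \<open>Rules for derivations, and division by two\<close>

lemma derivationD:
  assumes "\<delta> \<in> derivations"
  shows "\<delta> (a + b) = \<delta> a + \<delta> b" "\<delta> (a * b) = a * \<delta> b + b * \<delta> a"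
    "\<delta> 0 = 0" "\<delta> 1 = 0" "\<delta> (sum f S) = (\<Sum>s\<in>S. \<delta> (f s))"
proof -
  have add: "\<delta> (a + b) = \<delta> a + \<delta> b" and mult: "\<delta> (a * b) = a * \<delta> b + b * \<delta> a" for a b
    using assms by (auto simp: derivations_def)
  interpret additive \<delta> by standard (rule add)
  show "\<delta> (a + b) = \<delta> a + \<delta> b" "\<delta> (a * b) = a * \<delta> b + b * \<delta> a"
    "\<delta> 0 = 0" "\<delta> (sum f S) = (\<Sum>s\<in>S. \<delta> (f s))"
    by (fact add mult zero sum)+
  show "\<delta> 1 = 0" using mult[of 1 1] by simp
qed

lemma sum_svar_sq: "(\<Sum>i\<in>UNIV. svar i * svar i) = (1 :: 'k::field sphere_ring)"
  by (simp only: sum_3 svar_sphere)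

text \<open>Differentiating the sphere equation yields identities \<open>s + s = 0\<close>;
  multiplication by \<open>h\<close> reduces them to \<open>s = 0\<close>. This is where the
  hypothesis on the characteristic enters.\<close>

lemma cancel_two:
  assumes "CHAR('k::field) \<noteq> 2"
  obtains h :: "'k::field sphere_ring" where "h + h = 1"
proof
  have "(2 :: 'k) \<noteq> 0"
  proof
    assume "(2 :: 'k) = 0"
    then have "CHAR('k) dvd 2"
      using of_nat_eq_0_iff_char_dvd[of 2, where ?'a = 'k] by simp
    \<comment> \<open>A characteristic dividing 2 is 1 or 2; the value 1 is impossible and 2 is
      excluded by assumption.\<close>
    then have "CHAR('k) \<le> 2" "CHAR('k) \<noteq> 0" by (auto dest: dvd_imp_le intro!: Nat.gr0I)
    then show False using assms CHAR_not_1[where ?'a = 'k] by linarith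
  qed
  then have "(1/2 + 1/2 :: 'k) = 1" by (simp add: field_simps)
  then show "sconst (1/2 :: 'k) + sconst (1/2) = 1"
    by transfer (simp add: pconst_def single_add[symmetric] sphere_eq_def)
qed

section \<open>The module of differentials\<close>

lemma abs_kaehler_eqI:
  assumes "u - v \<in> kaehler_relations"
  shows "abs_kaehler u = abs_kaehler v"
  using assms by (simp add: kaehler.abs_eq_iff kaehler_eq_def free_module.span_base)

lemma kd_add: "kd (a + b) = kd a + kd b"
  unfolding kd.abs_eq plus_kaehler.abs_eq
  by (rule abs_kaehler_eqI) (auto simp: kaehler_relations_def diff_diff_eq[symmetric])

lemma kd_mult: "kd (a * b) = kscale a (kd b) + kscale b (kd a)"
  unfolding kd.abs_eq kscale.abs_eq plus_kaehler.abs_eq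
  by (rule abs_kaehler_eqI) (auto simp: kaehler_relations_def diff_diff_eq[symmetric])

lemma kd_1: "kd 1 = 0"
  using kd_mult[of 1 1] by simp

lemma kd_sconst: "kd (sconst c) = 0"
proof -
  have "kd (sconst c * a) = kscale (sconst c) (kd a)" for a
    unfolding kd.abs_eq kscale.abs_eq
    by (rule abs_kaehler_eqI) (auto simp: kaehler_relations_def)
  from this[of 1] show ?thesis by (simp add: kd_1)
qed

lemma span_kd: "kaehler_module.span (range kd) = UNIV"
proof -
  have "abs_kaehler u \<in> kaehler_module.span (range kd)" for u :: "'a sphere_ring \<Rightarrow>\<^sub>0 'a sphere_ring"
  proof (induction u rule: update_induct)
    case const
    then show ?case by (simp add: zero_kaehler.abs_eq[symmetric] kaehler_module.span_zero)
  next
    case (update u a c)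
    \<comment> \<open>Here \<open>a\<close> lies outside the support of \<open>u\<close>, so
      overwriting its coefficient is the same as adding a term.\<close>
    have "Poly_Mapping.update a c u = u + free_scale c (symb a)"
      using update(1)
      by (intro poly_mapping_eqI)
        (simp add: symb_def lookup_add lookup_update lookup_single in_keys_iff when_def, auto)
    then have "abs_kaehler (Poly_Mapping.update a c u) = abs_kaehler u + kscale c (kd a)"
      by (simp add: plus_kaehler.abs_eq kscale.abs_eq kd.abs_eq)
    with update show ?case
      by (simp add: kaehler_module.span_add kaehler_module.span_scale kaehler_module.span_base)
  qed
  then have "x \<in> kaehler_module.span (range kd)" for x :: "'a kaehler"
    by (induction x rule: kaehler.abs_induct)
  then show ?thesis by blast
qed

text \<open>The ring is generated by constants and coordinates; \<open>kd\<close> kills constants,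
  and the Leibniz rule expresses the differential of a product through those of its factors.\<close>

lemma span_kd_svar: "kaehler_module.span (range (\<lambda>j. kd (svar j))) = UNIV"
proof -
  have "kd a \<in> kaehler_module.span (range (\<lambda>j. kd (svar j)))" for a :: "'a sphere_ring"
    by (induction a rule: sphere_ring_induct)
      (auto simp: kd_add kd_mult kd_sconst kaehler_module.span_zero
        intro: kaehler_module.span_add kaehler_module.span_scale kaehler_module.span_base)
  then have "range kd \<subseteq> kaehler_module.span (range (\<lambda>j. kd (svar j :: 'a sphere_ring)))"
    by blast
  then show ?thesis
    using kaehler_module.span_minimal kaehler_module.subspace_span span_kd by blast
qed

lemma kaehler_hom_eqI:
  assumes "module_hom kscale s f" "module_hom kscale s g"
    and "\<And>j. f (kd (svar j)) = g (kd (svar j))"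
  shows "f = g"
proof
  fix \<omega>
  interpret module_hom kscale s f by fact
  interpret module_pair kscale s ..
  show "f \<omega> = g \<omega>"
    by (rule module_hom_eq_on_span[OF assms(1,2), of "range (\<lambda>j. kd (svar j))"])
      (auto simp: assms(3) span_kd_svar)
qed

section \<open>The universal property and the coordinate maps\<close>

definition linear_extension ::
  "('k::field sphere_ring \<Rightarrow> 'k sphere_ring) \<Rightarrow> ('k sphere_ring \<Rightarrow>\<^sub>0 'k sphere_ring) \<Rightarrow> 'k sphere_ring"
  where "linear_extension \<delta> u =
    (\<Sum>a\<in>Poly_Mapping.keys u. Poly_Mapping.lookup u a * \<delta> a)"

lemma linear_extension_superset:
  assumes "finite S" "Poly_Mapping.keys u \<subseteq> S"
  shows "linear_extension \<delta> u = (\<Sum>a\<in>S. Poly_Mapping.lookup u a * \<delta> a)"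
  unfolding linear_extension_def
  by (rule sum.mono_neutral_left) (use assms in \<open>auto simp: in_keys_iff\<close>)

lemma module_self: "module ((*) :: 'a::comm_ring_1 \<Rightarrow> 'a \<Rightarrow> 'a)"
  by unfold_locales (simp_all add: algebra_simps)

lemma linear_extension_hom:
  fixes \<delta> :: "'k::field sphere_ring \<Rightarrow> 'k sphere_ring"
  shows "module_hom free_scale (*) (linear_extension \<delta>)"
proof (unfold module_hom_iff, intro conjI allI)
  show "module (free_scale :: 'k sphere_ring \<Rightarrow> ('k sphere_ring \<Rightarrow>\<^sub>0 'k sphere_ring) \<Rightarrow> _)"
    by (rule free_module.module_axioms)
  show "module ((*) :: 'k sphere_ring \<Rightarrow> _)" by (rule module_self)
  fix u v :: "'k sphere_ring \<Rightarrow>\<^sub>0 'k sphere_ring" and c :: "'k sphere_ring"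
  let ?S = "Poly_Mapping.keys u \<union> Poly_Mapping.keys v"
  have "Poly_Mapping.keys (u + v) \<subseteq> ?S" by (rule keys_add)
  then show "linear_extension \<delta> (u + v) = linear_extension \<delta> u + linear_extension \<delta> v"
    by (simp add: linear_extension_superset[of ?S] lookup_add distrib_right sum.distrib)
  have "Poly_Mapping.keys (free_scale c u) \<subseteq> Poly_Mapping.keys u"
    by (auto simp: in_keys_iff)
  then show "linear_extension \<delta> (free_scale c u) = c * linear_extension \<delta> u"
    by (simp add: linear_extension_superset[of "Poly_Mapping.keys u"] sum_distrib_left mult.assoc)
qed

lemma linear_extension_symb [simp]: "linear_extension \<delta> (symb a) = \<delta> a"
  by (simp add: linear_extension_superset[of "{a}"] symb_def)

text \<open>The three families of relations say exactly what a derivation satisfies, so its linear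
  extension to the free module kills them and their span.\<close>

lemma linear_extension_kaehler_eq:
  assumes "\<delta> \<in> derivations" "kaehler_eq u v"
  shows "linear_extension \<delta> u = linear_extension \<delta> v"
proof -
  interpret module_hom free_scale "(*)" "linear_extension \<delta>" by (rule linear_extension_hom)
  have "linear_extension \<delta> r = 0" if "r \<in> kaehler_relations" for r
    using that assms(1) by (auto simp: kaehler_relations_def derivations_def diff scale)
  then have "linear_extension \<delta> (u - v) = 0"
    using assms(2) eq_0_on_span unfolding kaehler_eq_def by blast
  then show ?thesis by (simp add: diff)
qed

lift_definition coord :: "3 \<Rightarrow> 'k::field kaehler \<Rightarrow> 'k sphere_ring"
  is "\<lambda>i. linear_extension (tangent_deriv i)"
  by (rule linear_extension_kaehler_eq[OF tangent_deriv_derivation])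

lemma coord_hom: "module_hom kscale (*) (coord i :: 'k::field kaehler \<Rightarrow> 'k sphere_ring)"
proof (unfold module_hom_iff, intro conjI allI)
  show "module (kscale :: 'k sphere_ring \<Rightarrow> _)" by (rule kaehler_module.module_axioms)
  show "module ((*) :: 'k sphere_ring \<Rightarrow> _)" by (rule module_self)
  interpret module_hom free_scale "(*)" "linear_extension \<delta>" for \<delta> :: "'k sphere_ring \<Rightarrow> _"
    by (rule linear_extension_hom)
  fix u v :: "'k kaehler" and c :: "'k sphere_ring"
  show "coord i (u + v) = coord i u + coord i v"
    by (induction u rule: kaehler.abs_induct, induction v rule: kaehler.abs_induct)
      (simp add: coord.abs_eq plus_kaehler.abs_eq add)
  show "coord i (kscale c u) = c * coord i u"
    by (induction u rule: kaehler.abs_induct) (simp add: coord.abs_eq kscale.abs_eq scale)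
qed

lemma coord_kd: "coord i (kd a) = tangent_deriv i a"
  by (simp add: coord.abs_eq kd.abs_eq)

text \<open>The universal property applied to \<open>tangent_deriv i\<close> gives existence, and
  agreement on generators gives uniqueness, so the definite description denotes this map.\<close>

lemma xi_eq_coord: "xi i = coord i"
  unfolding xi_def
  by (rule the_equality)
    (auto simp: coord_hom coord_kd tangent_deriv_svar intro: kaehler_hom_eqI)

lemma xi_hom: "module_hom kscale (*) (xi i)"
  by (simp add: xi_eq_coord coord_hom)

lemma xi_kd_svar: "xi i (kd (svar j)) = (if i = j then 1 else 0) - svar i * svar j"
  by (simp add: xi_eq_coord coord_kd tangent_deriv_svar)

lemmas xi_zero = module_hom.zero[OF xi_hom]
  and xi_add = module_hom.add[OF xi_hom]
  and xi_scale = module_hom.scale[OF xi_hom]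
  and xi_sum = module_hom.sum[OF xi_hom]

section \<open>Tangency relations and the projective basis\<close>

lemma sum_svar_kd_svar:
  assumes "CHAR('k::field) \<noteq> 2"
  shows "(\<Sum>i\<in>UNIV. kscale (svar i) (kd (svar i))) = (0 :: 'k::field kaehler)"
proof -
  obtain h :: "'k sphere_ring" where h: "h + h = 1" using cancel_two[OF assms] .
  let ?s = "\<Sum>i\<in>UNIV. kscale (svar i) (kd (svar i)) :: 'k kaehler"
  \<comment> \<open>Applying \<open>kd\<close> to the sphere equation produces twice the desired
    sum.\<close>
  have "?s + ?s = kd (\<Sum>i\<in>UNIV. svar i * svar i)"
    by (simp add: sum_3 kd_add kd_mult)
  also have "\<dots> = 0" by (simp add: sum_svar_sq kd_1)
  finally have "kscale h (?s + ?s) = 0" by simp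
  then have "kscale (h + h) ?s = 0"
    by (simp only: kaehler_module.scale_left_distrib kaehler_module.scale_right_distrib)
  then show ?thesis by (simp add: h)
qed

text \<open>Differentiating the sphere equation shows that the vector \<open>\<delta> x\<close> is
  tangent, that is, orthogonal to \<open>x\<close>.\<close>

lemma sum_svar_derivation:
  assumes "CHAR('k::field) \<noteq> 2" "\<delta> \<in> derivations"
  shows "(\<Sum>i\<in>UNIV. svar i * \<delta> (svar i)) = (0 :: 'k::field sphere_ring)"
proof -
  obtain h :: "'k sphere_ring" where h: "h + h = 1" using cancel_two[OF assms(1)] .
  let ?s = "\<Sum>i\<in>UNIV. svar i * \<delta> (svar i)"
  have "?s + ?s = \<delta> (\<Sum>i\<in>UNIV. svar i * svar i)"
    unfolding derivationD(5,2)[OF assms(2)] sum.distrib ..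
  also have "\<dots> = 0" by (simp add: sum_svar_sq derivationD[OF assms(2)])
  finally have "h * (?s + ?s) = 0" by simp
  then have "(h + h) * ?s = 0" by (simp only: distrib_left distrib_right)
  then show ?thesis by (simp add: h)
qed

lemma sum_if_kscale:
  "(\<Sum>i\<in>UNIV. kscale (if i = j then c i else 0) (g i)) = kscale (c j) (g (j :: 3))"
proof -
  have "(\<Sum>i\<in>UNIV. kscale (if i = j then c i else 0) (g i)) =
      (\<Sum>i\<in>UNIV. if i = j then kscale (c i) (g i) else 0)"
    by (rule sum.cong) auto
  then show ?thesis by simp
qed

text \<open>On the generator \<open>dx_j\<close> the sum is
  \<open>dx_j - x_j (x_1 dx_1 + x_2 dx_2 + x_3 dx_3)\<close>, and the bracket vanishes. This makes
  the \<open>dx_i\<close> and \<open>xi i\<close> a projective basis.\<close>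

lemma xi_expansion:
  assumes "CHAR('k::field) \<noteq> 2"
  shows "(\<Sum>i\<in>UNIV. kscale (xi i \<omega>) (kd (svar i))) = (\<omega> :: 'k::field kaehler)"
proof -
  have "(\<lambda>\<omega>. \<Sum>i\<in>UNIV. kscale (xi i \<omega>) (kd (svar i))) = (\<lambda>\<omega>. \<omega> :: 'k kaehler)"
  proof (rule kaehler_hom_eqI)
    show "module_hom kscale kscale (\<lambda>\<omega>. \<Sum>i\<in>UNIV. kscale (xi i \<omega>) (kd (svar i :: 'k sphere_ring)))"
      by (simp add: module_hom_iff kaehler_module.module_axioms xi_add xi_scale
          kaehler_module.scale_left_distrib sum.distrib kaehler_module.scale_sum_right)
    show "module_hom kscale kscale (\<lambda>\<omega> :: 'k kaehler. \<omega>)"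
      by (simp add: module_hom_iff kaehler_module.module_axioms)
    fix j
    have "(\<Sum>i\<in>UNIV. kscale (xi i (kd (svar j))) (kd (svar i))) =
        kd (svar j :: 'k sphere_ring) -
        kscale (svar j) (\<Sum>i\<in>UNIV. kscale (svar i) (kd (svar i)))"
      by (simp add: xi_kd_svar kaehler_module.scale_left_diff_distrib sum_subtractf
          sum_if_kscale kaehler_module.scale_sum_right mult.commute)
    then show "(\<Sum>i\<in>UNIV. kscale (xi i (kd (svar j))) (kd (svar i))) = kd (svar j :: 'k sphere_ring)"
      by (simp add: sum_svar_kd_svar[OF assms])
  qed
  then show ?thesis by meson
qed

text \<open>On \<open>dx_j\<close> the sum is \<open>x_j - x_j (x_1^2 + x_2^2 + x_3^2) = 0\<close>:
  coordinate vectors of differentials are orthogonal to \<open>x\<close>.\<close>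

lemma sum_svar_xi: "(\<Sum>i\<in>UNIV. svar i * xi i \<omega>) = (0 :: 'k::field sphere_ring)"
proof -
  have "(\<lambda>\<omega>. \<Sum>i\<in>UNIV. svar i * xi i \<omega>) = (\<lambda>_ :: 'k kaehler. 0 :: 'k sphere_ring)"
  proof (rule kaehler_hom_eqI)
    show "module_hom kscale (*) (\<lambda>\<omega> :: 'k kaehler. \<Sum>i\<in>UNIV. svar i * xi i \<omega>)"
      by (simp add: module_hom_iff kaehler_module.module_axioms module_self xi_add xi_scale
          distrib_left sum.distrib sum_distrib_left mult_ac)
    show "module_hom kscale (*) (\<lambda>_ :: 'k kaehler. 0 :: 'k sphere_ring)"
      by (simp add: module_hom_iff kaehler_module.module_axioms module_self)
    fix j
    have "(\<Sum>i\<in>UNIV. svar i * xi i (kd (svar j))) =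
        (\<Sum>i\<in>UNIV. (if i = j then svar j else 0) - svar j * (svar i * svar i :: 'k sphere_ring))"
      by (rule sum.cong) (auto simp: xi_kd_svar algebra_simps)
    also have "\<dots> = 0"
      unfolding sum_subtractf sum_distrib_left[symmetric] sum_svar_sq by simp
    finally show "(\<Sum>i\<in>UNIV. svar i * xi i (kd (svar j))) = (0 :: 'k sphere_ring)" .
  qed
  then show ?thesis by meson
qed

section \<open>Curvature and trace\<close>

text \<open>Differentiating coordinates leaves the tangent plane, and \<open>pairing\<close>
  measures the normal part that \<open>nabla\<close> removes. The second derivatives cancel against
  the bracket term, and only derivatives of these normal corrections survive.\<close>

lemma curvature_formula:
  fixes \<delta> \<eta> :: "'k::field sphere_ring \<Rightarrow> 'k sphere_ring"
  defines "nabla \<equiv> \<lambda>\<delta> \<omega>. \<Sum>i\<in>UNIV. kscale (\<delta> (xi i \<omega>)) (kd (svar i))"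
    and "pairing \<equiv> \<lambda>\<delta> \<omega>. \<Sum>j\<in>UNIV. \<delta> (svar j) * xi j \<omega>"
  assumes char: "CHAR('k) \<noteq> 2" and d: "\<delta> \<in> derivations" "\<eta> \<in> derivations"
  shows "curvature nabla \<delta> \<eta> \<omega> = (\<Sum>i\<in>UNIV.
    kscale (pairing \<eta> \<omega> * \<delta> (svar i) - pairing \<delta> \<omega> * \<eta> (svar i)) (kd (svar i)))"
proof -
  \<comment> \<open>This comes from applying the derivation to the orthogonality relation
    \<open>sum_svar_xi\<close>.\<close>
  have pairing_eq: "pairing \<eta> \<omega> = - (\<Sum>k\<in>UNIV. svar k * \<eta> (xi k \<omega>))" if "\<eta> \<in> derivations" for \<eta>
  proof -
    have "0 = \<eta> (\<Sum>k\<in>UNIV. svar k * xi k \<omega>)"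
      by (simp add: sum_svar_xi derivationD[OF that])
    also have "\<dots> = (\<Sum>k\<in>UNIV. svar k * \<eta> (xi k \<omega>)) + pairing \<eta> \<omega>"
      by (simp add: pairing_def derivationD[OF that] sum.distrib mult.commute)
    finally show ?thesis by (simp add: eq_neg_iff_add_eq_0 add.commute)
  qed
  \<comment> \<open>The matrix of the \<open>xi i (dx_k)\<close> projects to the tangent plane, so
    the normal part of the differentiated vector is subtracted.\<close>
  have xi_nabla: "xi i (nabla \<eta> \<omega>) = \<eta> (xi i \<omega>) + svar i * pairing \<eta> \<omega>"
    if "\<eta> \<in> derivations" for i \<eta>
  proof -
    have "xi i (nabla \<eta> \<omega>) = (\<Sum>k\<in>UNIV. (if k = i then \<eta> (xi i \<omega>) else 0)
        - svar i * (svar k * \<eta> (xi k \<omega>)))"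
      unfolding nabla_def xi_sum xi_scale xi_kd_svar
      by (rule sum.cong) (auto simp: algebra_simps)
    also have "\<dots> = \<eta> (xi i \<omega>) + svar i * pairing \<eta> \<omega>"
      unfolding sum_subtractf sum_distrib_left[symmetric] pairing_eq[OF that] by simp
    finally show ?thesis .
  qed
  have nabla_nabla: "nabla \<delta> (nabla \<eta> \<omega>) =
      (\<Sum>i\<in>UNIV. kscale (\<delta> (\<eta> (xi i \<omega>)) + pairing \<eta> \<omega> * \<delta> (svar i)) (kd (svar i)))"
    if d: "\<delta> \<in> derivations" "\<eta> \<in> derivations" for \<delta> \<eta>
  proof -
    have "nabla \<delta> (nabla \<eta> \<omega>) = (\<Sum>i\<in>UNIV. kscale (\<delta> (xi i (nabla \<eta> \<omega>))) (kd (svar i)))"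
      by (simp add: nabla_def)
    also have "\<dots> = (\<Sum>i\<in>UNIV.
        kscale (\<delta> (\<eta> (xi i \<omega>)) + pairing \<eta> \<omega> * \<delta> (svar i)) (kd (svar i))
        + kscale (\<delta> (pairing \<eta> \<omega>)) (kscale (svar i) (kd (svar i))))"
      by (simp add: xi_nabla[OF d(2)] derivationD[OF d(1)] kaehler_module.scale_left_distrib
          algebra_simps)
    \<comment> \<open>The derivative of the pairing appears only as a factor of
      \<open>x_1 dx_1 + x_2 dx_2 + x_3 dx_3 = 0\<close>.\<close>
    also have "\<dots> = (\<Sum>i\<in>UNIV.
        kscale (\<delta> (\<eta> (xi i \<omega>)) + pairing \<eta> \<omega> * \<delta> (svar i)) (kd (svar i)))"
      unfolding sum.distrib kaehler_module.scale_sum_right[symmetric] sum_svar_kd_svar[OF char]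
      by simp
    finally show ?thesis .
  qed
  have "nabla (lie_bracket \<delta> \<eta>) \<omega> =
      (\<Sum>i\<in>UNIV. kscale (\<delta> (\<eta> (xi i \<omega>)) - \<eta> (\<delta> (xi i \<omega>))) (kd (svar i)))"
    by (simp add: nabla_def lie_bracket_def)
  then show ?thesis
    unfolding curvature_def nabla_nabla[OF d] nabla_nabla[OF d(2,1)]
    by (simp add: sum_subtractf sum.distrib kaehler_module.scale_left_diff_distrib
        kaehler_module.scale_left_distrib)
qed

section \<open>The trace of an endomorphism of a projective module\<close>

lemma trace_basis_independent:
  assumes \<phi>: "module_hom scale scale \<phi>"
    and bs: "projective_basis scale bs" and cs: "projective_basis scale cs"
  shows "(\<Sum>(e, f)\<leftarrow>bs. f (\<phi> e)) = (\<Sum>(e, f)\<leftarrow>cs. f (\<phi> e))"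
proof -
  interpret module_hom scale scale \<phi> by (rule \<phi>)
  have hom_sum_list: "module_hom scale s g \<Longrightarrow> g (\<Sum>x\<leftarrow>xs. h x) = (\<Sum>x\<leftarrow>xs. g (h x))"
    for s :: "'a \<Rightarrow> 'c::ab_group_add \<Rightarrow> 'c" and g h and xs :: "'d list"
    by (induction xs) (simp_all add: module_hom.zero module_hom.add)
  have swap: "(\<Sum>x\<leftarrow>xs. \<Sum>y\<leftarrow>ys. g x y) = (\<Sum>y\<leftarrow>ys. \<Sum>x\<leftarrow>xs. g x y)"
    for g :: "'d \<Rightarrow> 'd \<Rightarrow> 'a" and xs ys
    by (induction xs) (simp_all add: sum_list_addf)
  \<comment> \<open>Expanding \<open>\<phi> e\<close> in the basis \<open>cs\<close> turns the trace
    over \<open>bs\<close> into a double sum over both bases.\<close>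
  have expand: "f (\<phi> e) = (\<Sum>c\<leftarrow>cs. snd c (\<phi> e) * f (fst c))" if "(e', f) \<in> set bs" for e e' f
  proof -
    have f: "module_hom scale (*) f" using bs that by (auto simp: projective_basis_def)
    have "\<phi> e = (\<Sum>c\<leftarrow>cs. scale (snd c (\<phi> e)) (fst c))"
      using cs by (simp add: projective_basis_def case_prod_unfold)
    then have "f (\<phi> e) = f (\<Sum>c\<leftarrow>cs. scale (snd c (\<phi> e)) (fst c))" by simp
    then show ?thesis by (simp add: hom_sum_list[OF f] module_hom.scale[OF f])
  qed
  have "(\<Sum>(e, f)\<leftarrow>bs. f (\<phi> e)) = (\<Sum>b\<leftarrow>bs. \<Sum>c\<leftarrow>cs. snd c (\<phi> (fst b)) * snd b (fst c))"
    by (rule arg_cong[where f = sum_list], rule map_cong) (auto simp: expand)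
  also have "\<dots> = (\<Sum>c\<leftarrow>cs. \<Sum>b\<leftarrow>bs. snd c (\<phi> (fst b)) * snd b (fst c))"
    by (rule swap)
  also have "\<dots> = (\<Sum>(e, f)\<leftarrow>cs. f (\<phi> e))"
  \<comment> \<open>For fixed \<open>c\<close>, the sum over \<open>bs\<close> is, by linearity, the
    expansion of the basis vector of \<open>c\<close> in the basis \<open>bs\<close>.\<close>
  proof (rule arg_cong[where f = sum_list], rule map_cong, rule refl)
    fix c assume c: "c \<in> set cs"
    obtain e f where ef: "c = (e, f)" by (cases c)
    have f: "module_hom scale (*) f" using cs c by (auto simp: projective_basis_def ef)
    have "e = (\<Sum>b\<leftarrow>bs. scale (snd b e) (fst b))"
      using bs by (simp add: projective_basis_def case_prod_unfold)
    then have "f (\<phi> e) = f (\<phi> (\<Sum>b\<leftarrow>bs. scale (snd b e) (fst b)))" by simp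
    also have "\<dots> = (\<Sum>b\<leftarrow>bs. f (\<phi> (fst b)) * snd b e)"
      by (simp add: hom_sum_list[OF f] hom_sum_list[OF \<phi>] scale module_hom.scale[OF f] mult.commute)
    finally show "(\<Sum>b\<leftarrow>bs. snd c (\<phi> (fst b)) * snd b (fst c)) = (case c of (e, f) \<Rightarrow> f (\<phi> e))"
      by (simp add: ef)
  qed
  finally show ?thesis .
qed

lemma proj_trace_eq:
  assumes "module_hom scale scale \<phi>" "projective_basis scale bs"
  shows "proj_trace scale \<phi> = (\<Sum>(e, f)\<leftarrow>bs. f (\<phi> e))"
  unfolding proj_trace_def
  by (rule the_equality) (use assms trace_basis_independent[OF assms(1)] in blast)+

lemma kaehler_trace:
  fixes \<phi> :: "'k::field kaehler \<Rightarrow> 'k kaehler"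
  assumes "CHAR('k) \<noteq> 2" "module_hom kscale kscale \<phi>"
  shows "proj_trace kscale \<phi> = (\<Sum>i\<in>UNIV. xi i (\<phi> (kd (svar i))))"
proof -
  let ?bs = "map (\<lambda>i. (kd (svar i :: 'k sphere_ring), xi i)) [1, 2, 3]"
  have "projective_basis kscale ?bs"
    using xi_expansion[OF assms(1)]
    by (simp add: projective_basis_def xi_hom sum_3 add.assoc)
  then show ?thesis
    by (simp add: proj_trace_eq[OF assms(2)] sum_3 add.assoc)
qed

section \<open>The curvature matrix, its trace and non-flatness\<close>

lemma sum_derivation_xi_kd:
  fixes \<delta> :: "'k::field sphere_ring \<Rightarrow> 'k sphere_ring"
  assumes "CHAR('k) \<noteq> 2" "\<delta> \<in> derivations"
  shows "(\<Sum>j\<in>UNIV. \<delta> (svar j) * xi j (kd (svar i))) = \<delta> (svar i)"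
    and "(\<Sum>j\<in>UNIV. \<delta> (svar j) * xi i (kd (svar j))) = \<delta> (svar i)"
proof -
  \<comment> \<open>The orthogonal projection to the tangent plane fixes the tangent vector
    \<open>\<delta> x\<close>.\<close>
  have "(\<Sum>j\<in>UNIV. \<delta> (svar j) * xi j (kd (svar i))) =
      (\<Sum>j\<in>UNIV. (if j = i then \<delta> (svar i) else 0) - svar i * (svar j * \<delta> (svar j)))"
    by (rule sum.cong) (auto simp: xi_kd_svar algebra_simps)
  also have "\<dots> = \<delta> (svar i)"
    unfolding sum_subtractf sum_distrib_left[symmetric] sum_svar_derivation[OF assms] by simp
  finally show *: "(\<Sum>j\<in>UNIV. \<delta> (svar j) * xi j (kd (svar i))) = \<delta> (svar i)" .
  \<comment> \<open>Symmetry of the projection matrix gives the second form.\<close>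
  have "xi i (kd (svar j)) = (xi j (kd (svar i)) :: 'k sphere_ring)" for j
    by (auto simp: xi_kd_svar mult.commute)
  with * show "(\<Sum>j\<in>UNIV. \<delta> (svar j) * xi i (kd (svar j))) = \<delta> (svar i)" by simp
qed

text \<open>Pairing \<open>\<delta> x\<close> and \<open>\<eta> x\<close> with the projection matrix
  returns these tangent vectors, which leaves an antisymmetric matrix built from them.\<close>

lemma xi_curvature_kd:
  fixes \<delta> \<eta> :: "'k::field sphere_ring \<Rightarrow> 'k sphere_ring"
  defines "nabla \<equiv> \<lambda>\<delta> \<omega>. \<Sum>i\<in>UNIV. kscale (\<delta> (xi i \<omega>)) (kd (svar i))"
  assumes char: "CHAR('k) \<noteq> 2" and d: "\<delta> \<in> derivations" "\<eta> \<in> derivations"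
  shows "xi i (curvature nabla \<delta> \<eta> (kd (svar j))) =
    \<eta> (svar j) * \<delta> (svar i) - \<delta> (svar j) * \<eta> (svar i)"
proof -
  have "xi i (curvature nabla \<delta> \<eta> (kd (svar j))) =
      \<eta> (svar j) * (\<Sum>k\<in>UNIV. \<delta> (svar k) * xi i (kd (svar k)))
      - \<delta> (svar j) * (\<Sum>k\<in>UNIV. \<eta> (svar k) * xi i (kd (svar k)))"
    unfolding nabla_def curvature_formula[OF char d] xi_sum xi_scale
      sum_derivation_xi_kd(1)[OF char d(1)] sum_derivation_xi_kd(1)[OF char d(2)]
    by (simp only: left_diff_distrib sum_subtractf sum_distrib_left mult.assoc)
  then show ?thesis
    by (simp only: sum_derivation_xi_kd(2)[OF char d(1)] sum_derivation_xi_kd(2)[OF char d(2)])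
qed

lemma trace_curvature_eq_0:
  fixes \<delta> \<eta> :: "'k::field sphere_ring \<Rightarrow> 'k sphere_ring"
  defines "nabla \<equiv> \<lambda>\<delta> \<omega>. \<Sum>i\<in>UNIV. kscale (\<delta> (xi i \<omega>)) (kd (svar i))"
  assumes char: "CHAR('k) \<noteq> 2" and d: "\<delta> \<in> derivations" "\<eta> \<in> derivations"
  shows "proj_trace kscale (curvature nabla \<delta> \<eta>) = 0"
proof -
  define pairing where "pairing \<delta> \<omega> = (\<Sum>j\<in>UNIV. \<delta> (svar j) * xi j \<omega>)"
    for \<delta> :: "'k sphere_ring \<Rightarrow> 'k sphere_ring" and \<omega> :: "'k kaehler"
  have curv: "curvature nabla \<delta> \<eta> = (\<lambda>\<omega>. \<Sum>i\<in>UNIV.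
      kscale (pairing \<eta> \<omega> * \<delta> (svar i) - pairing \<delta> \<omega> * \<eta> (svar i)) (kd (svar i)))"
    using curvature_formula[OF char d] by (simp add: nabla_def pairing_def fun_eq_iff)
  have pairing_hom: "pairing \<delta> (u + v) = pairing \<delta> u + pairing \<delta> v"
    "pairing \<delta> (kscale c u) = c * pairing \<delta> u" for \<delta> c u v
    by (simp_all add: pairing_def xi_add xi_scale distrib_left sum.distrib sum_distrib_left
        mult_ac)
  \<comment> \<open>Linearity over the ring, needed for the trace formula, is visible because the
    argument now enters only through the linear pairings.\<close>
  have "module_hom kscale kscale (curvature nabla \<delta> \<eta>)"
    unfolding module_hom_iff curv
    by (simp add: kaehler_module.module_axioms pairing_hom kaehler_module.scale_sum_right
        sum.distrib sum_subtractf algebra_simps)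
  from kaehler_trace[OF char this] show ?thesis
    \<comment> \<open>Each diagonal entry is zero by commutativity.\<close>
    by (simp add: nabla_def xi_curvature_kd[OF char d] mult.commute)
qed

text \<open>At the point \<open>(0, 0, 1)\<close> the sphere polynomial vanishes while
  \<open>x_3^2\<close> has the value 1.\<close>

lemma svar3_sq_neq_0: "svar 3 * svar 3 \<noteq> (0 :: 'k::field sphere_ring)"
proof (transfer, rule notI)
  assume "sphere_eq (pvar 3 * pvar 3) (0 :: 'k poly3)"
  then obtain q :: "'k poly3" where q: "pvar 3 * pvar 3 = sphere_poly * q"
    by (auto simp: sphere_eq_def)
  define a :: "3 \<Rightarrow> 'k" where "a = (\<lambda>i. if i = 3 then 1 else 0)"
  have "(sphere_poly :: 'k poly3) = pvar 1 * pvar 1 + pvar 2 * pvar 2 + pvar 3 * pvar 3 + pconst (- 1)"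
    by (simp add: sphere_poly_def power2_eq_square pconst_def single_uminus)
  then have "peval a sphere_poly = peval a (pvar 1 * pvar 1 + pvar 2 * pvar 2 + pvar 3 * pvar 3 + pconst (- 1))"
    by (rule arg_cong)
  then have "peval a sphere_poly = 0"
    by (simp add: peval_add peval_mult a_def pconst_def peval_single)
  then have "peval a (pvar 3 * pvar 3) = 0" by (simp add: q peval_mult)
  then show False by (simp add: peval_mult a_def)
qed

lemma curvature_neq_0:
  fixes nabla :: "('k::field sphere_ring \<Rightarrow> 'k sphere_ring) \<Rightarrow> 'k kaehler \<Rightarrow> 'k kaehler"
  defines "nabla \<equiv> \<lambda>\<delta> \<omega>. \<Sum>i\<in>UNIV. kscale (\<delta> (xi i \<omega>)) (kd (svar i))"
  assumes char: "CHAR('k) \<noteq> 2"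
  shows "curvature nabla (tangent_deriv 1) (tangent_deriv 2) \<noteq> (\<lambda>_. 0)"
proof
  let ?x = "svar :: 3 \<Rightarrow> 'k sphere_ring"
  assume "curvature nabla (tangent_deriv 1) (tangent_deriv 2) = (\<lambda>_. 0)"
  then have "xi 2 (curvature nabla (tangent_deriv 1) (tangent_deriv 2) (kd (?x 1))) = 0"
    by (simp add: xi_zero)
  moreover have "xi 2 (curvature nabla (tangent_deriv 1) (tangent_deriv 2) (kd (?x 1))) =
      - (?x 3 * ?x 3)"
  proof -
    have x3: "?x 3 * ?x 3 = 1 - ?x 1 * ?x 1 - ?x 2 * ?x 2"
      using svar_sphere[where ?'k = 'k] by (simp add: algebra_simps)
    \<comment> \<open>The quartic terms cancel, leaving \<open>-(1 - x_1^2 - x_2^2)\<close>, which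
      the sphere equation identifies with \<open>-x_3^2\<close>.\<close>
    have "xi 2 (curvature nabla (tangent_deriv 1) (tangent_deriv 2) (kd (?x 1))) =
        (?x 2 * ?x 1) * (?x 1 * ?x 2) - (1 - ?x 1 * ?x 1) * (1 - ?x 2 * ?x 2)"
      unfolding nabla_def xi_curvature_kd[OF char tangent_deriv_derivation tangent_deriv_derivation]
      by (simp add: tangent_deriv_svar)
    then show ?thesis unfolding x3 by (simp add: algebra_simps)
  qed
  ultimately show False using svar3_sq_neq_0[where ?'k = 'k] by simp
qed

theorem corollary4p5:
  fixes nabla :: "('k::field sphere_ring \<Rightarrow> 'k sphere_ring) \<Rightarrow> 'k kaehler \<Rightarrow> 'k kaehler"
  assumes "CHAR('k) \<noteq> 2"
    and "nabla = (\<lambda>\<delta> \<omega>. \<Sum>i\<in>UNIV. kscale (\<delta> (xi i \<omega>)) (kd (svar i)))"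
  shows "(\<exists>\<delta>\<in>derivations. \<exists>\<eta>\<in>derivations. curvature nabla \<delta> \<eta> \<noteq> (\<lambda>_. 0))
       \<and> (\<forall>\<delta>\<in>derivations. \<forall>\<eta>\<in>derivations. proj_trace kscale (curvature nabla \<delta> \<eta>) = 0)
       \<and> c1_class nabla = \<one>\<^bsub>lr_cohomology derivations 2\<^esub>"
proof (intro conjI)
  show "\<exists>\<delta>\<in>derivations. \<exists>\<eta>\<in>derivations. curvature nabla \<delta> \<eta> \<noteq> (\<lambda>_. 0)"
    using curvature_neq_0[OF assms(1)] tangent_deriv_derivation unfolding assms(2) by blast
  show trace: "\<forall>\<delta>\<in>derivations. \<forall>\<eta>\<in>derivations. proj_trace kscale (curvature nabla \<delta> \<eta>) = 0"
    using trace_curvature_eq_0[OF assms(1)] unfolding assms(2) by blast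
  have "\<delta>s ! 0 \<in> derivations \<and> \<delta>s ! 1 \<in> derivations"
    if "\<delta>s \<in> tuples derivations 2" for \<delta>s :: "('k sphere_ring \<Rightarrow> 'k sphere_ring) list"
    using that nth_mem[of 0 \<delta>s] nth_mem[of 1 \<delta>s] by (auto simp: tuples_def)
  \<comment> \<open>Outside pairs of derivations the cochain is zero by definition, so it is the
    zero function.\<close>
  then have "trace_curvature nabla = (\<lambda>_. 0)"
    using trace by (auto simp: trace_curvature_def fun_eq_iff)
  \<comment> \<open>The coset of the zero cocycle is the set of coboundaries itself, the identity of
    the quotient group.\<close>
  then show "c1_class nabla = \<one>\<^bsub>lr_cohomology derivations 2\<^esub>"
    by (simp add: c1_class_def cohomology_class_def lr_cohomology_def FactGroup_def
        r_coset_def cocycle_group_def)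
qed

end
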